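(* Let $(\mathbb{X},\oplus,\otimes,\mathbb{0},\mathbb{1})$ be a linearly ordered radicable idempotent semifield, let $n\geq 1$ and $\mathbf{p},\mathbf{q},\mathbf{g},\mathbf{h}\in\mathbb{X}^{n}$. Let $\mathbf{p}$ be a nonzero vector, $\mathbf{q}$ a regular vector, and $\mathbf{h}$ a regular vector such that $\mathbf{h}^{-}\mathbf{g}\leq\mathbb{1}$. Consider the problem of minimizing $\mathbf{q}^{-}\mathbf{x}\mathbf{x}^{-}\mathbf{p}$ over all regular vectors $\mathbf{x}\in\mathbb{X}^{n}$ subject to $\mathbf{g}\leq\mathbf{x}\leq\mathbf{h}$. Then the minimum in this problem is equal to $$\theta=\mathbf{q}^{-}(\mathbf{I}\oplus\mathbf{g}\mathbf{h}^{-})\mathbf{p},$$ and all regular solutions of the problem are given by $$\mathbf{x}=(\mathbf{I}\oplus\theta^{-1}\mathbf{p}\mathbf{q}^{-})\mathbf{u},\qquad \mathbf{g}\leq\mathbf{u}\leq(\mathbf{h}^{-}(\mathbf{I}\oplus\theta^{-1}\mathbf{p}\mathbf{q}^{-}))^{-};$$ that is, a regular vector $\mathbf{x}$ is a solution of the problem if and only if it has this form for some $\mathbf{u}\in\mathbb{X}^{n}$ satisfying the stated double inequality.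
   Context: Idempotent semifield: $\mathbb{X}$ is a set with two associative and commutative operations $\oplus$ (addition) and $\otimes$ (multiplication, sign usually omitted) with neutral elements $\mathbb{0}$ and $\mathbb{1}$ respectively; addition is idempotent ($x\oplus x=x$), multiplication distributes over addition, and each $x\neq\mathbb{0}$ has a multiplicative inverse $x^{-1}$ (and $\mathbb{0}$ is absorbing for multiplication). The order is defined by $x\leq y$ iff $x\oplus y=y$ and is assumed linear, so $x\oplus y=\max(x,y)$; "minimize" refers to this order. Radicable means that $x^{m}=a$ has a solution for every $a\neq\mathbb{0}$ and every integer $m\geq1$. Vectors and matrices: vectors in $\mathbb{X}^{n}$ are column vectors; matrix/vector operations follow the usual rules with $\oplus,\otimes$ in place of ordinary addition and multiplication; inequalities are componentwise. $\mathbf{I}$ is the identity matrix ($\mathbb{1}$ on the diagonal, $\mathbb{0}$ elsewhere). A vector is nonzero if it has at least one entry $\neq\mathbb{0}$, and regular if none of its entries is $\mathbb{0}$. For a nonzero column vector $\mathbf{x}=(x_{i})$, the multiplicative conjugate transpose is the row vector $\mathbf{x}^{-}=(x_{i}^{-})$ with $x_{i}^{-}=x_{i}^{-1}$ if $x_{i}\neq\mathbb{0}$ and $x_{i}^{-}=\mathbb{0}$ otherwise; similarly, the conjugate transpose of a row vector is the column vector obtained by inverting its nonzero entries. *)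

theory Defs
  imports "HOL-Analysis.Analysis"
begin

text \<open>
  Semifield addition is \<open>+\<close>, multiplication \<open>*\<close>, with neutral elements \<open>0\<close> and \<open>1\<close>.
  The value of \<open>inverse 0\<close> is left unspecified. Division, which the class \<open>inverse\<close> brings
  along, is fixed as multiplication by the inverse.
\<close>

class idem_semifield = comm_semiring_1 + inverse +
  assumes add_idem: "x + x = x"
    and semifield_inverse: "x \<noteq> 0 \<Longrightarrow> inverse x * x = 1"
    and semifield_divide: "x / y = x * inverse y"

class linordered_idem_semifield = idem_semifield + linorder +
  assumes le_iff_add_eq: "x \<le> y \<longleftrightarrow> x + y = y"

class radicable_idem_semifield = linordered_idem_semifield +
  assumes radicable: "\<lbrakk>a \<noteq> 0; m \<ge> 1\<rbrakk> \<Longrightarrow> \<exists>x. x ^ m = a"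

text \<open>
  Row and column vectors share the type \<open>'a ^ 'n\<close>, so a single \<open>conj_transpose\<close> serves both.
  With \<open>r\<close> a row and \<open>c\<close> a column, the product \<open>r c\<close> is \<open>scalar_product r c\<close>
  and the matrix \<open>c r\<close> is \<open>outer_product c r\<close>.
  The order \<open>\<le>\<close> on \<open>'a ^ 'n\<close> is the componentwise one.
\<close>

definition regular :: "'a::zero ^ 'n \<Rightarrow> bool" where
  "regular x \<longleftrightarrow> (\<forall>i. x $ i \<noteq> 0)"

definition conj_transpose :: "'a::idem_semifield ^ 'n \<Rightarrow> 'a ^ 'n" where
  "conj_transpose x = (\<chi> i. if x $ i = 0 then 0 else inverse (x $ i))"

definition outer_product :: "'a::times ^ 'm \<Rightarrow> 'a ^ 'n \<Rightarrow> 'a ^ 'n ^ 'm" where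
  "outer_product c r = (\<chi> i j. c $ i * r $ j)"

definition objective :: "'a::idem_semifield ^ 'n \<Rightarrow> 'a ^ 'n \<Rightarrow> 'a ^ 'n \<Rightarrow> 'a" where
  "objective p q x =
     scalar_product (conj_transpose q) x * scalar_product (conj_transpose x) p"

definition feasible ::
    "'a::linordered_idem_semifield ^ 'n \<Rightarrow> 'a ^ 'n \<Rightarrow> 'a ^ 'n \<Rightarrow> bool" where
  "feasible g h x \<longleftrightarrow> regular x \<and> g \<le> x \<and> x \<le> h"

end

theory Submission
  imports Defs
begin

text \<open>
  Write \<open>r y\<close> for \<open>scalar_product r y\<close>. Everything rests on one residuation principle: for
  regular \<open>h\<close>, the inequality \<open>h\<^sup>- y \<le> c\<close> holds exactly when \<open>y \<le> c h\<close>
  (\<open>conj_transpose_residuation\<close>).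

  Since \<open>\<theta> = q\<^sup>- p \<oplus> (q\<^sup>- g) (h\<^sup>- p)\<close>, the bound \<open>\<theta> \<le> q\<^sup>- x x\<^sup>- p\<close> splits in two. Residuation turns
  the trivial \<open>x\<^sup>- p \<le> x\<^sup>- p\<close> into \<open>p \<le> (x\<^sup>- p) x\<close>; applying \<open>q\<^sup>-\<close> bounds the first term.
  As \<open>x \<le> h\<close>, also \<open>p \<le> (x\<^sup>- p) h\<close>, that is \<open>h\<^sup>- p \<le> x\<^sup>- p\<close>, which together with \<open>g \<le> x\<close> bounds the
  second.

  Since \<open>p\<close> is nonzero, \<open>p \<le> 0 q\<close> fails, so \<open>q\<^sup>- p\<close> and with it \<open>\<theta>\<close> is nonzero and thus invertible.
  Again by residuation, \<open>q\<^sup>- x x\<^sup>- p \<le> \<theta>\<close> means \<open>\<theta>\<^sup>-\<^sup>1 p q\<^sup>- x \<le> x\<close>, that is \<open>M x = x\<close>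
  (\<open>objective_le_iff_fixed\<close>). Because \<open>q\<^sup>- p \<le> \<theta>\<close>, the matrix \<open>M\<close> is multiplicatively
  idempotent, so its fixed points are exactly the vectors \<open>M u\<close>. For these, \<open>g \<le> u\<close> gives
  \<open>g \<le> M u\<close>, since \<open>M\<close> dominates the identity, and \<open>M u \<le> h\<close> means \<open>h\<^sup>- M u \<le> 1\<close>, that is
  \<open>u \<le> (h\<^sup>- M)\<^sup>-\<close>. In the other direction a solution \<open>x\<close> is its own parameter \<open>u\<close>. The interval
  for \<open>u\<close> is nonempty because \<open>h\<^sup>- M g = h\<^sup>- g \<oplus> \<theta>\<^sup>-\<^sup>1 (h\<^sup>- p) (q\<^sup>- g) \<le> 1\<close>; hence the
  bound \<open>\<theta>\<close> is attained.
\<close>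

section \<open>Order in a linearly ordered idempotent semifield\<close>

lemma semifield_zero_le: "(0::'a::linordered_idem_semifield) \<le> x"
  by (simp add: le_iff_add_eq)

lemma semifield_add_le_iff:
  fixes x y z :: "'a::linordered_idem_semifield"
  shows "x + y \<le> z \<longleftrightarrow> x \<le> z \<and> y \<le> z"
proof
  assume z: "x + y \<le> z"
  have "a \<le> a + b" for a b :: 'a
    by (simp add: le_iff_add_eq add.assoc[symmetric] add_idem)
  then have "x \<le> x + y" "y \<le> x + y"
    by (simp, subst add.commute, simp)
  with z show "x \<le> z \<and> y \<le> z" by (meson order_trans)
next
  assume "x \<le> z \<and> y \<le> z"
  then show "x + y \<le> z" by (simp add: le_iff_add_eq add.assoc)
qed

lemma semifield_mult_mono:
  fixes x y c :: "'a::linordered_idem_semifield"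
  assumes "x \<le> y"
  shows "c * x \<le> c * y"
  using assms by (simp add: le_iff_add_eq distrib_left[symmetric])

lemma semifield_inverse_mult_le_iff:
  fixes a y c :: "'a::linordered_idem_semifield"
  assumes "a \<noteq> 0"
  shows "inverse a * y \<le> c \<longleftrightarrow> y \<le> c * a"
proof -
  have inv: "a * inverse a = 1" "inverse a * a = 1"
    using semifield_inverse[OF assms] by (simp_all add: mult.commute)
  have "a * (inverse a * y) = y"
    by (simp add: mult.assoc[symmetric] inv)
  moreover have "inverse a * (c * a) = c"
    by (subst mult.commute) (simp add: mult.assoc inv)
  ultimately show ?thesis
    using semifield_mult_mono[of "inverse a * y" c a]
      semifield_mult_mono[of y "c * a" "inverse a"]
    by (auto simp: mult.commute[of a c])
qed

lemma semifield_sum_le_iff: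
  fixes f :: "'b \<Rightarrow> 'a::linordered_idem_semifield"
  assumes "finite A"
  shows "sum f A \<le> c \<longleftrightarrow> (\<forall>i\<in>A. f i \<le> c)"
  using assms by (induction A) (auto simp: semifield_add_le_iff semifield_zero_le)

lemma semifield_inverse_nonzero:
  fixes a :: "'a::idem_semifield"
  assumes "a \<noteq> 0"
  shows "inverse a \<noteq> 0"
  using semifield_inverse[OF assms] by auto

lemma semifield_inverse_inverse:
  fixes a :: "'a::idem_semifield"
  assumes "a \<noteq> 0"
  shows "inverse (inverse a) = a"
proof -
  have "inverse (inverse a) * (inverse a * a) = a"
    using semifield_inverse[OF semifield_inverse_nonzero[OF assms]]
    by (simp add: mult.assoc[symmetric])
  then show ?thesis by (simp add: semifield_inverse[OF assms])
qed

section \<open>Vectors and the residuation of conjugate transposition\<close>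

lemma vec_add_le_iff:
  fixes x y z :: "'a::linordered_idem_semifield ^ 'n"
  shows "x + y \<le> z \<longleftrightarrow> x \<le> z \<and> y \<le> z"
  by (auto simp: less_eq_vec_def semifield_add_le_iff)

lemma regular_mono:
  fixes x y :: "'a::linordered_idem_semifield ^ 'n"
  assumes "regular x" "x \<le> y"
  shows "regular y"
  using assms unfolding regular_def less_eq_vec_def
  by (metis antisym semifield_zero_le)

lemma regular_conj_transpose: "regular h \<Longrightarrow> regular (conj_transpose h)"
  by (simp add: regular_def conj_transpose_def semifield_inverse_nonzero)

lemma conj_transpose_involutive: "regular h \<Longrightarrow> conj_transpose (conj_transpose h) = h"
  by (simp add: regular_def conj_transpose_def vec_eq_iff semifield_inverse_nonzero
      semifield_inverse_inverse)

lemma scalar_product_add_right: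
  fixes r x y :: "'a::comm_semiring_1 ^ 'n"
  shows "scalar_product r (x + y) = scalar_product r x + scalar_product r y"
  by (simp add: scalar_product_def sum.distrib distrib_left)

lemma scalar_product_mono:
  fixes r x y :: "'a::linordered_idem_semifield ^ 'n"
  assumes "x \<le> y"
  shows "scalar_product r x \<le> scalar_product r y"
proof -
  have "x + y = y"
    using assms by (simp add: vec_eq_iff less_eq_vec_def le_iff_add_eq)
  then have "scalar_product r x + scalar_product r y = scalar_product r y"
    by (simp flip: scalar_product_add_right)
  then show ?thesis by (simp add: le_iff_add_eq)
qed

lemma scalar_product_scale_right:
  fixes r x :: "'a::comm_semiring_1 ^ 'n"
  shows "scalar_product r (c *s x) = c * scalar_product r x"
  by (simp add: scalar_product_def sum_distrib_left mult.left_commute)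

text \<open>
  Multiplication by a nonzero entry of \<open>h\<close> is an order isomorphism, so each term
  of the maximum \<open>h\<^sup>- y\<close> can be solved for \<open>y\<close> separately.
\<close>

lemma conj_transpose_residuation:
  fixes h y :: "'a::linordered_idem_semifield ^ 'n"
  assumes "regular h"
  shows "scalar_product (conj_transpose h) y \<le> c \<longleftrightarrow> y \<le> c *s h"
  using assms
  by (simp add: scalar_product_def conj_transpose_def regular_def less_eq_vec_def
      semifield_sum_le_iff semifield_inverse_mult_le_iff)

corollary conj_transpose_residuation_1:
  fixes h y :: "'a::linordered_idem_semifield ^ 'n"
  assumes "regular h"
  shows "scalar_product (conj_transpose h) y \<le> 1 \<longleftrightarrow> y \<le> h"
  using conj_transpose_residuation[OF assms, of y 1] by simp

section \<open>The identity plus a matrix of rank one\<close>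

lemma mat_1_plus_outer_product_mult_vec:
  fixes p r u :: "'a::comm_semiring_1 ^ 'n"
  shows "(mat 1 + map_matrix ((*) c) (outer_product p r)) *v u
         = u + (c * scalar_product r u) *s p"
proof -
  have "(map_matrix ((*) c) (outer_product p r)) *v u = (c * scalar_product r u) *s p"
    by (simp add: vec_eq_iff matrix_vector_mult_def map_matrix_def outer_product_def
        scalar_product_def sum_distrib_left sum_distrib_right mult_ac)
  then show ?thesis by (simp add: matrix_vector_mult_add_rdistrib)
qed

lemma vec_mult_mat_1_plus_outer_product:
  fixes p r s :: "'a::comm_semiring_1 ^ 'n"
  shows "s v* (mat 1 + map_matrix ((*) c) (outer_product p r))
         = s + (c * scalar_product s p) *s r"
proof -
  have "s v* map_matrix ((*) c) (outer_product p r) = (c * scalar_product s p) *s r"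
    by (simp add: vec_eq_iff vector_matrix_mult_def map_matrix_def outer_product_def
        scalar_product_def sum_distrib_left sum_distrib_right mult_ac)
  then show ?thesis by (simp add: vector_matrix_mult_add_rdistrib)
qed

text \<open>
  Under \<open>r p \<le> \<theta>\<close> the cross term \<open>\<theta>\<^sup>-\<^sup>2 p (r p) r\<close> in the square of
  \<open>I \<oplus> \<theta>\<^sup>-\<^sup>1 p r\<close> is absorbed by \<open>\<theta>\<^sup>-\<^sup>1 p r\<close>.
\<close>

lemma mat_1_plus_outer_product_idem:
  fixes p r u :: "'a::linordered_idem_semifield ^ 'n"
  assumes "\<theta> \<noteq> 0" "scalar_product r p \<le> \<theta>"
    and M: "M = mat 1 + map_matrix ((*) (inverse \<theta>)) (outer_product p r)"
  shows "M *v (M *v u) = M *v u"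
proof -
  have le: "inverse \<theta> * scalar_product r p \<le> 1"
    using assms by (simp add: semifield_inverse_mult_le_iff)
  have absorb: "scalar_product r u * (1 + inverse \<theta> * scalar_product r p) = scalar_product r u"
    using le by (simp add: le_iff_add_eq add.commute)
  have "scalar_product r (M *v u) = scalar_product r u * (1 + inverse \<theta> * scalar_product r p)"
    by (simp add: M mat_1_plus_outer_product_mult_vec scalar_product_add_right
        scalar_product_scale_right distrib_left mult_ac)
  then have "scalar_product r (M *v u) = scalar_product r u"
    by (simp only: absorb)
  then show ?thesis
    by (simp add: M mat_1_plus_outer_product_mult_vec vec_eq_iff add.assoc add_idem)
qed

section \<open>The constrained minimization problem\<close>

text \<open>
  The optimality condition \<open>q\<^sup>- x x\<^sup>- p \<le> \<theta>\<close> is the residuated form of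
  \<open>(\<theta>\<^sup>-\<^sup>1 q\<^sup>- x) p \<le> x\<close>.
\<close>

lemma objective_le_iff_fixed:
  fixes p q x :: "'a::linordered_idem_semifield ^ 'n"
  assumes "\<theta> \<noteq> 0" "regular x"
    and M: "M = mat 1 + map_matrix ((*) (inverse \<theta>)) (outer_product p (conj_transpose q))"
  shows "objective p q x \<le> \<theta> \<longleftrightarrow> M *v x = x"
proof -
  let ?a = "inverse \<theta> * scalar_product (conj_transpose q) x"
  have "objective p q x \<le> \<theta> \<longleftrightarrow> inverse \<theta> * objective p q x \<le> 1"
    using assms(1) by (simp add: semifield_inverse_mult_le_iff)
  also have "inverse \<theta> * objective p q x = scalar_product (conj_transpose x) (?a *s p)"
    by (simp add: objective_def scalar_product_scale_right mult.assoc)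
  also have "\<dots> \<le> 1 \<longleftrightarrow> ?a *s p \<le> x"
    by (rule conj_transpose_residuation_1[OF assms(2)])
  also have "\<dots> \<longleftrightarrow> x + ?a *s p = x"
    by (simp add: less_eq_vec_def vec_eq_iff le_iff_add_eq add.commute)
  finally show ?thesis
    by (simp add: M mat_1_plus_outer_product_mult_vec)
qed

lemma objective_lower_bound:
  fixes p q g h x :: "'a::linordered_idem_semifield ^ 'n"
  assumes "feasible g h x" "regular h"
  shows "scalar_product (conj_transpose q) p
         + scalar_product (conj_transpose q) g * scalar_product (conj_transpose h) p
         \<le> objective p q x"
proof -
  let ?q = "conj_transpose q" and ?c = "scalar_product (conj_transpose x) p"
  have x: "regular x" "g \<le> x" "x \<le> h"
    using assms(1) by (auto simp: feasible_def)
  have p_le: "p \<le> ?c *s x"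
    using conj_transpose_residuation[OF x(1), of p ?c] by simp
  have "scalar_product ?q p \<le> objective p q x"
    using scalar_product_mono[OF p_le, of ?q]
    by (simp add: scalar_product_scale_right objective_def mult.commute)
  moreover have "scalar_product ?q g * scalar_product (conj_transpose h) p \<le> objective p q x"
  proof -
    have "?c *s x \<le> ?c *s h"
      using x(3) by (simp add: less_eq_vec_def semifield_mult_mono)
    with p_le have "scalar_product (conj_transpose h) p \<le> ?c"
      using conj_transpose_residuation[OF assms(2), of p ?c] by (meson order_trans)
    then have "scalar_product ?q g * scalar_product (conj_transpose h) p
        \<le> scalar_product ?q g * ?c"
      by (rule semifield_mult_mono)
    also have "\<dots> \<le> scalar_product ?q x * ?c"
      using semifield_mult_mono[OF scalar_product_mono[OF x(2), of ?q], of ?c]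
      by (simp add: mult.commute)
    finally show ?thesis by (simp add: objective_def)
  qed
  ultimately show ?thesis by (simp add: semifield_add_le_iff)
qed

text \<open>
  The upper bound on the parameter \<open>u\<close> is the constraint \<open>M u \<le> h\<close> solved for \<open>u\<close>.
  The row \<open>h\<^sup>- M\<close> can be conjugated entrywise because it dominates the regular row \<open>h\<^sup>-\<close>.
\<close>

lemma mult_vec_le_iff_le_conj_transpose:
  fixes p r h u :: "'a::linordered_idem_semifield ^ 'n"
  assumes "regular h"
    and M: "M = mat 1 + map_matrix ((*) c) (outer_product p r)"
  shows "M *v u \<le> h \<longleftrightarrow> u \<le> conj_transpose (conj_transpose h v* M)"
    and "regular (conj_transpose (conj_transpose h v* M))"
proof -
  let ?h = "conj_transpose h" and ?w = "conj_transpose (conj_transpose h v* M)"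
  have hM: "?h v* M = ?h + (c * scalar_product ?h p) *s r"
    unfolding M by (rule vec_mult_mat_1_plus_outer_product)
  moreover have "?h \<le> ?h + (c * scalar_product ?h p) *s r"
    using vec_add_le_iff by blast
  ultimately have reg: "regular (?h v* M)"
    using regular_mono[OF regular_conj_transpose[OF assms(1)]] by simp
  then show w: "regular ?w"
    by (rule regular_conj_transpose)
  have assoc: "scalar_product ?h (M *v u) = scalar_product (?h v* M) u"
  proof -
    have "scalar_product (?h + d *s r) u = scalar_product ?h u + d * scalar_product r u" for d
      by (simp add: scalar_product_def distrib_right sum.distrib sum_distrib_left mult.assoc)
    then show ?thesis
      unfolding hM
      by (simp add: M mat_1_plus_outer_product_mult_vec scalar_product_add_right
          scalar_product_scale_right mult_ac)
  qed
  have "M *v u \<le> h \<longleftrightarrow> scalar_product (?h v* M) u \<le> 1"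
    unfolding assoc[symmetric] by (rule conj_transpose_residuation_1[OF assms(1), symmetric])
  also have "\<dots> \<longleftrightarrow> u \<le> ?w"
    using conj_transpose_residuation_1[OF w] by (simp add: conj_transpose_involutive[OF reg])
  finally show "M *v u \<le> h \<longleftrightarrow> u \<le> ?w" .
qed

theorem theorem8:
  fixes p q g h :: "'a::radicable_idem_semifield ^ 'n"
    and \<theta> :: 'a
    and M :: "'a ^ 'n ^ 'n"
  assumes "p \<noteq> 0"
    and "regular q"
    and "regular h"
    and "scalar_product (conj_transpose h) g \<le> 1"
    and \<theta>: "\<theta> = scalar_product (conj_transpose q)
               ((mat 1 + outer_product g (conj_transpose h)) *v p)"
    and M: "M = mat 1 + map_matrix ((*) (inverse \<theta>)) (outer_product p (conj_transpose q))"
  shows "(\<exists>x. feasible g h x \<and> objective p q x = \<theta>)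
       \<and> (\<forall>x. feasible g h x \<longrightarrow> \<theta> \<le> objective p q x)
       \<and> (\<forall>x. regular x \<longrightarrow>
            (is_arg_min (objective p q) (feasible g h) x \<longleftrightarrow>
             (\<exists>u. g \<le> u \<and> u \<le> conj_transpose (conj_transpose h v* M) \<and> x = M *v u)))"
proof -
  let ?q = "conj_transpose q" and ?h = "conj_transpose h"
  let ?w = "conj_transpose (conj_transpose h v* M)"
  have "outer_product g ?h = map_matrix ((*) 1) (outer_product g ?h)"
    by (simp add: vec_eq_iff map_matrix_def)
  then have \<theta>_eq: "\<theta> = scalar_product ?q p + scalar_product ?q g * scalar_product ?h p"
    unfolding \<theta> using mat_1_plus_outer_product_mult_vec[of 1 g ?h p]
    by (simp add: scalar_product_add_right scalar_product_scale_right mult.commute)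
  then have qp_le: "scalar_product ?q p \<le> \<theta>"
    and qghp_le: "scalar_product ?q g * scalar_product ?h p \<le> \<theta>"
    using semifield_add_le_iff[of _ _ \<theta>] by auto
  have \<theta>_nz: "\<theta> \<noteq> 0"
  proof
    assume "\<theta> = 0"
    with qp_le have "p \<le> 0 *s q"
      using conj_transpose_residuation[OF assms(2)] by blast
    then have "p = 0"
      by (auto simp: less_eq_vec_def vec_eq_iff intro: antisym semifield_zero_le)
    with assms(1) show False ..
  qed
  have lower: "\<theta> \<le> objective p q x" if "feasible g h x" for x
    using objective_lower_bound[OF that assms(3)] \<theta>_eq by simp
  have Mu: "M *v u = u + (inverse \<theta> * scalar_product ?q u) *s p" for u
    unfolding M by (rule mat_1_plus_outer_product_mult_vec)
  have u_le: "u \<le> M *v u" for u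
    unfolding Mu using vec_add_le_iff by blast
  have idem: "M *v (M *v u) = M *v u" for u
    using mat_1_plus_outer_product_idem[OF \<theta>_nz qp_le M] .
  note le_h = mult_vec_le_iff_le_conj_transpose(1)[OF assms(3) M]
  have w_regular: "regular ?w"
    using mult_vec_le_iff_le_conj_transpose(2)[OF assms(3) M] .

  have solution: "feasible g h (M *v u) \<and> objective p q (M *v u) = \<theta>"
    if "regular (M *v u)" "g \<le> u" "u \<le> ?w" for u
  proof -
    have "feasible g h (M *v u)"
      using that u_le[of u] le_h[of u] by (auto simp: feasible_def)
    moreover have "objective p q (M *v u) \<le> \<theta>"
      using objective_le_iff_fixed[OF \<theta>_nz that(1) M] idem by blast
    ultimately show ?thesis using lower by (auto intro: antisym)
  qed

  \<comment> \<open>The largest admissible parameter \<open>?w\<close> is used as a witness: it is regular, while the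
     smallest one, \<open>g\<close>, may have zero entries.\<close>
  have "g \<le> ?w"
  proof -
    have "inverse \<theta> * (scalar_product ?q g * scalar_product ?h p) \<le> 1"
      using qghp_le \<theta>_nz by (simp add: semifield_inverse_mult_le_iff)
    then have "scalar_product ?h (M *v g) \<le> 1"
      using assms(4)
      by (simp add: Mu scalar_product_add_right scalar_product_scale_right
          semifield_add_le_iff mult.assoc)
    then show ?thesis
      using conj_transpose_residuation_1[OF assms(3)] le_h by blast
  qed
  then have attained: "\<exists>x. feasible g h x \<and> objective p q x = \<theta>"
    using solution[of ?w] regular_mono[OF w_regular u_le] by auto

  have "is_arg_min (objective p q) (feasible g h) x \<longleftrightarrow>
      (\<exists>u. g \<le> u \<and> u \<le> ?w \<and> x = M *v u)" if x: "regular x" for x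
  proof
    assume "is_arg_min (objective p q) (feasible g h) x"
    then have feas: "feasible g h x" and "objective p q x \<le> \<theta>"
      using attained by (auto simp: is_arg_min_def not_less)
    then have fixed: "M *v x = x"
      using objective_le_iff_fixed[OF \<theta>_nz x M] by blast
    \<comment> \<open>A fixed point of \<open>M\<close> parametrizes itself.\<close>
    then have "g \<le> x \<and> x \<le> ?w \<and> x = M *v x"
      using feas le_h[of x] by (simp add: feasible_def)
    then show "\<exists>u. g \<le> u \<and> u \<le> ?w \<and> x = M *v u" ..
  next
    assume "\<exists>u. g \<le> u \<and> u \<le> ?w \<and> x = M *v u"
    then show "is_arg_min (objective p q) (feasible g h) x"
      using solution x lower by (auto simp: is_arg_min_def not_less)
  qed
  with attained lower show ?thesis by blast
qed

end
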